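(* For every integer $d\ge 3$ there exists a simple matroid $M$ of rank $d$ whose independence complex satisfies $h_d(\mathcal{I}(M))=2$.
   Context: A matroid is simple if every subset of size at most $2$ is independent (no loops and no parallel elements). $\mathcal{I}(M)$ is the independence complex of $M$ (faces are the independent sets), of dimension $d-1$ for rank $d$; its $h$-vector is defined by $\sum_{i=0}^d h_i t^i=\sum_{i=0}^d f_{i-1}t^i(1-t)^{d-i}$, where $f_{i}$ is the number of faces of cardinality $i+1$ and $f_{-1}=1$. *)

theory Defs
  imports Main "HOL-Computational_Algebra.Polynomial"
begin

locale matroid =
  fixes carrier :: "'a set" and indep :: "'a set \<Rightarrow> bool"
  assumes carrier_finite: "finite carrier"
    and indep_subset_carrier: "indep X \<Longrightarrow> X \<subseteq> carrier"
    and indep_empty: "indep {}"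
    and indep_subset: "indep X \<Longrightarrow> Y \<subseteq> X \<Longrightarrow> indep Y"
    and indep_augment: "indep X \<Longrightarrow> indep Y \<Longrightarrow> card X < card Y \<Longrightarrow>
      \<exists>y \<in> Y - X. indep (insert y X)"

locale simple_matroid = matroid +
  assumes simple: "X \<subseteq> carrier \<Longrightarrow> card X \<le> 2 \<Longrightarrow> indep X"

definition matroid_rank :: "'a set \<Rightarrow> ('a set \<Rightarrow> bool) \<Rightarrow> nat" where
  "matroid_rank E indep = Max (card ` {X. X \<subseteq> E \<and> indep X})"

definition independence_complex :: "'a set \<Rightarrow> ('a set \<Rightarrow> bool) \<Rightarrow> 'a set set" where
  "independence_complex E indep = {X. X \<subseteq> E \<and> indep X}"

text \<open>
  A finite simplicial complex is represented by the set of its faces, including the empty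
  face; \<open>face_size K\<close> is its dimension plus one.
\<close>

definition face_size :: "'a set set \<Rightarrow> nat" where
  "face_size K = Max (card ` K)"

text \<open>The index of the $f$-vector is the dimension of the faces, so it starts at $-1$.\<close>

definition f_vector :: "'a set set \<Rightarrow> int \<Rightarrow> nat" where
  "f_vector K i = card {F \<in> K. int (card F) = i + 1}"

text \<open>With $d$ = \<open>face_size K\<close>, this is $\sum_{i=0}^d f_{i-1} t^i (1-t)^{d-i}$.\<close>

definition h_poly :: "'a set set \<Rightarrow> int poly" where
  "h_poly K = (\<Sum>i = 0..face_size K.
     smult (int (f_vector K (int i - 1))) (monom 1 i * [:1, -1:] ^ (face_size K - i)))"

definition h_vector :: "'a set set \<Rightarrow> nat \<Rightarrow> int" where
  "h_vector K i = coeff (h_poly K) i"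

lemma f_vector_minus_one:
  assumes "finite (\<Union>K)" and "{} \<in> K"
  shows "f_vector K (-1) = 1"
proof -
  have "{F \<in> K. int (card F) = -1 + 1} = {{}}"
    using assms by (auto dest: finite_subset[OF Union_upper])
  thus ?thesis by (simp add: f_vector_def)
qed

lemma h_vector_generating_function:
  "(\<Sum>i = 0..face_size K. monom (h_vector K i) i) =
   (\<Sum>i = 0..face_size K.
     smult (int (f_vector K (int i - 1))) (monom 1 i * [:1, -1:] ^ (face_size K - i)))"
proof -
  have "degree (h_poly K) \<le> face_size K"
    unfolding h_poly_def
  proof (rule degree_sum_le, simp)
    fix i assume i: "i \<in> {0..face_size K}"
    have "degree ([:1, -1::int:] ^ (face_size K - i)) \<le> face_size K - i"
      by (rule order_trans[OF degree_power_le]) simp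
    with i have "degree (monom (1::int) i * [:1, -1:] ^ (face_size K - i)) \<le> face_size K"
      by (intro order_trans[OF degree_mult_le]) (auto simp: degree_monom_eq)
    thus "degree (smult (int (f_vector K (int i - 1)))
        (monom 1 i * [:1, -1:] ^ (face_size K - i))) \<le> face_size K"
      by (rule order_trans[OF degree_smult_le])
  qed
  from poly_as_sum_of_monoms'[OF this] show ?thesis
    by (simp add: h_vector_def h_poly_def atMost_atLeast0)
qed

end

theory Submission
  imports Defs
begin

text \<open>
  The matroid is the cycle matroid of a triangle and a \<open>d\<close>-cycle sharing an edge. Its dual has
  rank two, and the parallel classes of the dual are the three paths of lengths \<open>1\<close>, \<open>2\<close> and
  \<open>d - 1\<close> between the ends of the shared edge. Hence a set is independent iff its complement
  meets two of the classes. The top entry of the \<open>h\<close>-vector is, up to sign, the alternating sum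
  over the independent sets. Passing to complements and subtracting the sets contained in
  a single class from all sets gives the number of classes minus one.
\<close>

text \<open>For nonconstant \<open>c\<close> this is the dual of the rank-two matroid on
  \<open>E\<close> whose bases are the pairs with distinct colours. The fibres of \<open>c\<close>
  encode its parallel classes.\<close>

definition cocolor_indep :: "'a set \<Rightarrow> ('a \<Rightarrow> 'b) \<Rightarrow> 'a set \<Rightarrow> bool" where
  "cocolor_indep E c X \<longleftrightarrow> X \<subseteq> E \<and> (\<exists>u\<in>E - X. \<exists>v\<in>E - X. c u \<noteq> c v)"

lemma card_cocolor_indep_le:
  assumes "finite E" "cocolor_indep E c X"
  shows "card X + 2 \<le> card E"
proof -
  obtain u v where uv: "u \<in> E - X" "v \<in> E - X" "c u \<noteq> c v" and XE: "X \<subseteq> E"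
    using assms(2) unfolding cocolor_indep_def by blast
  have "u \<noteq> v" using uv(3) by blast
  then have "card {u, v} = 2" by simp
  moreover have "card {u, v} \<le> card (E - X)"
    using uv assms(1) by (intro card_mono) auto
  moreover have "card (E - X) = card E - card X" "card X \<le> card E"
    using XE assms(1) by (auto intro: card_Diff_subset finite_subset card_mono)
  ultimately show ?thesis by linarith
qed

text \<open>Augmentation: if no \<open>y\<close> in \<open>Y - X\<close> can be added, then
  \<open>E - X - {y}\<close> is monochromatic for each such \<open>y\<close>. Two choices of
  \<open>y\<close> and a third element outside \<open>X\<close> make all of \<open>E - X\<close>
  monochromatic, so \<open>X\<close> is not independent.\<close>

lemma matroid_cocolor_indep:
  assumes fin: "finite E" and two: "u \<in> E" "v \<in> E" "c u \<noteq> c v"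
  shows "matroid E (cocolor_indep E c)"
proof
  show "finite E" by fact
  show "X \<subseteq> E" if "cocolor_indep E c X" for X
    using that by (simp add: cocolor_indep_def)
  show "cocolor_indep E c {}"
    using two by (auto simp: cocolor_indep_def)
  show "cocolor_indep E c Y" if "cocolor_indep E c X" "Y \<subseteq> X" for X Y
    using that unfolding cocolor_indep_def by blast
next
  fix X Y
  assume X: "cocolor_indep E c X" and Y: "cocolor_indep E c Y" and less: "card X < card Y"
  have XE: "X \<subseteq> E" and YE: "Y \<subseteq> E"
    using X Y by (auto simp: cocolor_indep_def)
  have finX: "finite X" and finY: "finite Y"
    using XE YE fin by (auto intro: finite_subset)
  show "\<exists>y \<in> Y - X. cocolor_indep E c (insert y X)"
  proof (rule ccontr)
    assume "\<not> ?thesis"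
    then have const: "c p = c q" if "y \<in> Y - X" "p \<in> E - X - {y}" "q \<in> E - X - {y}" for y p q
      using that XE YE unfolding cocolor_indep_def by blast
    obtain y where y: "y \<in> Y - X"
      using less card_mono[OF finX, of Y] by force
    \<comment> \<open>With only one element \<open>y\<close> in \<open>Y - X\<close>, comparing
      cardinalities gives \<open>Y = insert y X\<close>, so \<open>y\<close> could be added after
      all.\<close>
    obtain z where z: "z \<in> Y - X" "z \<noteq> y"
    proof (rule ccontr)
      assume "\<not> thesis"
      with that have sub: "Y \<subseteq> insert y X" by blast
      have "card (insert y X) \<le> card Y" using less y finX by simp
      then have "Y = insert y X" using sub finX by (intro card_seteq) auto
      moreover have "\<not> cocolor_indep E c (insert y X)"
        using y \<open>\<not> (\<exists>y \<in> Y - X. cocolor_indep E c (insert y X))\<close> by blast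
      ultimately show False using Y by simp
    qed
    \<comment> \<open>\<open>E - X\<close> is larger than \<open>E - Y\<close>, which has at least
      two elements; this yields the third element \<open>w\<close>.\<close>
    have "card {y, z} < card (E - X)"
    proof -
      have "card {y, z} \<le> 2" by (simp add: card_insert_if)
      moreover have "card (E - X) = card E - card X"
        using XE finX by (simp add: card_Diff_subset)
      ultimately show ?thesis
        using card_cocolor_indep_le[OF fin Y] less by linarith
    qed
    then have "\<not> E - X \<subseteq> {y, z}"
      using card_mono[of "{y, z}" "E - X"] by auto
    then obtain w where w: "w \<in> E - X" "w \<noteq> y" "w \<noteq> z" by blast
    have "c w = c z" using const[OF y, of w z] w z YE by blast
    moreover have "c w = c y" using const[OF z(1), of w y] w y z(2) YE by blast
    ultimately have "c p = c w" if "p \<in> E - X" for p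
      using const[OF y, of p w] that w by (cases "p = y") auto
    then show False using X unfolding cocolor_indep_def by metis
  qed
qed

lemma matroid_rank_cocolor_indep:
  assumes fin: "finite E" and two: "u \<in> E" "v \<in> E" "c u \<noteq> c v"
  shows "matroid_rank E (cocolor_indep E c) = card E - 2"
  unfolding matroid_rank_def
proof (rule Max_eqI)
  show "finite (card ` {X. X \<subseteq> E \<and> cocolor_indep E c X})"
    using fin by auto
  show "n \<le> card E - 2" if "n \<in> card ` {X. X \<subseteq> E \<and> cocolor_indep E c X}" for n
    using that card_cocolor_indep_le[OF fin] by force
  \<comment> \<open>The complement of a pair with distinct colours is a basis and attains the upper
    bound.\<close>
  have "cocolor_indep E c (E - {u, v})"
    using two by (auto simp: cocolor_indep_def)
  moreover have "card (E - {u, v}) = card E - 2"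
  proof -
    have "u \<noteq> v" using two(3) by blast
    then have "card {u, v} = 2" by simp
    then show ?thesis using two card_Diff_subset[of "{u, v}" E] by simp
  qed
  ultimately show "card E - 2 \<in> card ` {X. X \<subseteq> E \<and> cocolor_indep E c X}"
    by (intro image_eqI[of _ _ "E - {u, v}"]) auto
qed

text \<open>Pairing \<open>Z\<close> with \<open>insert a Z\<close> for a fixed \<open>a\<close> in
  \<open>A\<close> cancels the terms.\<close>

lemma sum_minus_one_power_card_Pow:
  assumes "finite A" "A \<noteq> {}"
  shows "(\<Sum>Z\<in>Pow A. (-1) ^ card Z) = (0 :: 'a :: comm_ring_1)"
proof -
  obtain a B where A: "A = insert a B" "a \<notin> B"
    using assms(2) by (meson Set.set_insert ex_in_conv)
  then have finB: "finite B" using assms(1) by simp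
  have inj: "inj_on (insert a) (Pow B)"
    using A(2) by (auto simp: inj_on_def)
  have "(\<Sum>Z\<in>Pow A. (-1) ^ card Z)
      = (\<Sum>Z\<in>Pow B. (-1) ^ card Z) + (\<Sum>Z\<in>insert a ` Pow B. (-1) ^ card Z :: 'a)"
    unfolding A(1) Pow_insert using finB A(2) by (intro sum.union_disjoint) auto
  also have "(\<Sum>Z\<in>insert a ` Pow B. (-1) ^ card Z :: 'a)
      = (\<Sum>Z\<in>Pow B. - ((-1) ^ card Z))"
    unfolding sum.reindex[OF inj] comp_def
  proof (rule sum.cong)
    fix Z assume "Z \<in> Pow B"
    then have "a \<notin> Z" "finite Z" using A(2) finB by (auto intro: finite_subset)
    then show "(-1) ^ card (insert a Z) = - ((-1) ^ card Z :: 'a)" by simp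
  qed simp
  finally show ?thesis by (simp add: sum_negf)
qed

lemma sum_minus_one_power_nonconstant:
  fixes c :: "'a \<Rightarrow> 'b"
  assumes fin: "finite E" and ne: "E \<noteq> {}"
  shows "(\<Sum>Z | Z \<subseteq> E \<and> (\<exists>u\<in>Z. \<exists>v\<in>Z. c u \<noteq> c v). (-1) ^ card Z) = int (card (c ` E)) - 1"
proof -
  let ?N = "{Z. Z \<subseteq> E \<and> (\<exists>u\<in>Z. \<exists>v\<in>Z. c u \<noteq> c v)}"
  \<comment> \<open>The empty set lies in the power set of every fibre. Removing it makes the
    families \<open>fib k\<close> disjoint; it is counted once, separately, with contribution 1,
    while each colour contributes -1.\<close>
  define fib where "fib k = Pow {e \<in> E. c e = k} - {{}}" for k
  let ?s = "\<lambda>Z :: 'a set. (-1 :: int) ^ card Z"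
  have fin_fib: "finite (fib k)" for k using fin by (simp add: fib_def)
  have sum_fib: "sum ?s (fib k) = -1" if "k \<in> c ` E" for k
  proof -
    have "sum ?s (Pow {e \<in> E. c e = k}) = 0"
      using fin that by (intro sum_minus_one_power_card_Pow) auto
    then show ?thesis unfolding fib_def using fin by (simp add: sum_diff)
  qed
  have split: "Pow E = ?N \<union> insert {} (\<Union>k\<in>c ` E. fib k)"
  proof (intro equalityI subsetI)
    fix Z assume Z: "Z \<in> Pow E"
    show "Z \<in> ?N \<union> insert {} (\<Union>k\<in>c ` E. fib k)"
    proof (cases "Z \<in> ?N \<or> Z = {}")
      case False
      then obtain z where "z \<in> Z" by blast
      with False Z have "Z \<in> fib (c z)" "c z \<in> c ` E" unfolding fib_def by blast+
      then show ?thesis by blast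
    qed auto
  qed (auto simp: fib_def)
  have "0 = sum ?s (Pow E)"
    using sum_minus_one_power_card_Pow[OF fin ne, where 'a = int] by simp
  also have "\<dots> = sum ?s ?N + sum ?s (insert {} (\<Union>k\<in>c ` E. fib k))"
  proof -
    have "finite ?N" using fin by simp
    moreover have "finite (insert {} (\<Union>k\<in>c ` E. fib k))" using fin fin_fib by simp
    moreover have "?N \<inter> insert {} (\<Union>k\<in>c ` E. fib k) = {}"
    proof -
      have "c u = c v" if "Z \<in> fib k" "u \<in> Z" "v \<in> Z" for Z k u v
        using that unfolding fib_def by blast
      then show ?thesis by blast
    qed
    ultimately show ?thesis unfolding split by (rule sum.union_disjoint)
  qed
  also have "sum ?s (insert {} (\<Union>k\<in>c ` E. fib k)) = 1 + sum ?s (\<Union>k\<in>c ` E. fib k)"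
    using fin fin_fib by (subst sum.insert) (auto simp: fib_def)
  also have "sum ?s (\<Union>k\<in>c ` E. fib k) = (\<Sum>k\<in>c ` E. sum ?s (fib k))"
  proof (rule sum.UNION_disjoint)
    show "\<forall>k\<in>c ` E. \<forall>l\<in>c ` E. k \<noteq> l \<longrightarrow> fib k \<inter> fib l = {}"
    proof (intro ballI impI equals0I)
      fix k l Z assume "k \<noteq> l" and Z: "Z \<in> fib k \<inter> fib l"
      from Z obtain z where "z \<in> Z" unfolding fib_def by blast
      with Z have "c z = k" "c z = l" unfolding fib_def by blast+
      with \<open>k \<noteq> l\<close> show False by simp
    qed
  qed (use fin fin_fib in auto)
  also have "\<dots> = - int (card (c ` E))"
    using sum_fib by simp
  finally show ?thesis by simp
qed

text \<open>The summand t^i (1-t)^(d-i) has degree d and leading coefficient (-1)^(d-i), so a face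
  with i elements contributes exactly this sign to the coefficient of t^d.\<close>

lemma h_vector_face_size:
  assumes fin: "finite K"
  shows "h_vector K (face_size K) = (\<Sum>F\<in>K. (-1) ^ (face_size K - card F))"
proof -
  let ?d = "face_size K"
  have lead: "coeff ([:1, -1 :: int:] ^ m) m = (-1) ^ m" for m
    using lead_coeff_power[of "[:1, -1 :: int:]" m] by (simp add: degree_power_eq)
  have "h_vector K ?d = (\<Sum>i = 0..?d. int (f_vector K (int i - 1)) * (-1) ^ (?d - i))"
    unfolding h_vector_def h_poly_def coeff_sum
    by (intro sum.cong) (auto simp: coeff_monom_mult lead)
  also have "\<dots> = (\<Sum>i = 0..?d. \<Sum>F | F \<in> K \<and> card F = i. (-1) ^ (?d - card F))"
    by (intro sum.cong) (auto simp: f_vector_def)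
  also have "\<dots> = (\<Sum>F\<in>K. (-1) ^ (?d - card F))"
    using fin by (intro sum.group) (auto simp: face_size_def)
  finally show ?thesis .
qed

lemma h_vector_cocolor_indep:
  assumes fin: "finite E" and two: "u \<in> E" "v \<in> E" "c u \<noteq> c v"
  shows "h_vector (independence_complex E (cocolor_indep E c)) (card E - 2)
    = int (card (c ` E)) - 1"
proof -
  define K where "K = independence_complex E (cocolor_indep E c)"
  let ?N = "{Z. Z \<subseteq> E \<and> (\<exists>u\<in>Z. \<exists>v\<in>Z. c u \<noteq> c v)}"
  have size: "face_size K = card E - 2"
    using matroid_rank_cocolor_indep[OF assms]
    by (simp add: K_def face_size_def independence_complex_def matroid_rank_def)
  have "finite K" using fin by (auto simp: K_def independence_complex_def)
  then have "h_vector K (card E - 2) = (\<Sum>F\<in>K. (-1) ^ (card E - 2 - card F))"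
    using h_vector_face_size[of K] size by simp
  also have "\<dots> = (\<Sum>Z\<in>?N. (-1) ^ card Z)"
  proof (rule sum.reindex_bij_witness[of _ "\<lambda>Z. E - Z" "\<lambda>F. E - F"])
    fix F assume "F \<in> K"
    then have F: "F \<subseteq> E" "cocolor_indep E c F"
      by (auto simp: K_def independence_complex_def)
    then show "E - (E - F) = F" "E - F \<in> ?N"
      by (auto simp: cocolor_indep_def)
    have "card (E - F) = card E - card F"
      using F(1) fin by (simp add: card_Diff_subset finite_subset)
    \<comment> \<open>The exponents differ by 2, so the signs agree. The bound on
      \<open>card F\<close> ensures that the subtraction of naturals does not truncate.\<close>
    then have "card (E - F) = card E - 2 - card F + 2"
      using card_cocolor_indep_le[OF fin F(2)] by simp
    then show "(-1) ^ card (E - F) = (-1 :: int) ^ (card E - 2 - card F)"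
      by simp
  next
    fix Z assume "Z \<in> ?N"
    then show "E - (E - Z) = Z" "E - Z \<in> K"
      by (auto simp: K_def independence_complex_def cocolor_indep_def double_diff)
  qed
  also have "\<dots> = int (card (c ` E)) - 1"
    using two by (intro sum_minus_one_power_nonconstant fin) auto
  finally show ?thesis by (simp add: K_def)
qed

theorem theorem6p2:
  fixes d :: nat
  assumes "d \<ge> 3"
  shows "\<exists>(E :: nat set) indep. simple_matroid E indep \<and> matroid_rank E indep = d
    \<and> h_vector (independence_complex E indep) d = 2"
proof -
  define E :: "nat set" where "E = {..<d + 2}"
  \<comment> \<open>The classes {0}, {1, 2} and {3, ..., d + 1} have sizes 1, 2 and d - 1.\<close>
  define c :: "nat \<Rightarrow> nat" where "c i = (if i = 0 then 0 else if i \<le> 2 then 1 else 2)" for i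
  have E: "finite E" "card E = d + 2" by (simp_all add: E_def)
  have two: "0 \<in> E" "1 \<in> E" "c 0 \<noteq> c 1" by (auto simp: E_def c_def)
  interpret matroid E "cocolor_indep E c"
    by (rule matroid_cocolor_indep[OF E(1) two])
  have "simple_matroid E (cocolor_indep E c)"
  proof
    fix X assume X: "X \<subseteq> E" "card X \<le> 2"
    then have finX: "finite X" using E(1) by (blast intro: finite_subset)
    \<comment> \<open>Each triple used below lies in the union of two classes and hence omits one
      colour. As \<open>X\<close> contains none of the triples, the points \<open>p\<close>,
      \<open>q\<close>, \<open>r\<close> survive outside \<open>X\<close>. They cannot all share a
      colour, since each colour is omitted by one triple. That 4 is in \<open>E\<close> uses
      \<open>d \<ge> 3\<close>.\<close>
    have miss: "\<exists>p\<in>P. p \<notin> X" if "card P = 3" for P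
      using that X(2) card_mono[OF finX, of P] by force
    have in_E: "{0, 1, 2, 3, 4} \<subseteq> E" using assms by (auto simp: E_def)
    obtain p where p: "p \<in> {0, 1, 2}" "p \<notin> X"
      using miss[of "{0, 1, 2}"] by auto
    obtain q where q: "q \<in> {0, 3, 4}" "q \<notin> X"
      using miss[of "{0, 3, 4}"] by auto
    obtain r where r: "r \<in> {1, 3, 4}" "r \<notin> X"
      using miss[of "{1, 3, 4}"] by auto
    have "c p \<noteq> c q \<or> c p \<noteq> c r"
      using p q r by (auto simp: c_def)
    then show "cocolor_indep E c X"
      using p q r X(1) in_E unfolding cocolor_indep_def by blast
  qed
  moreover have "c ` E = {0, 1, 2}"
  proof (intro equalityI subsetI)
    fix k :: nat assume "k \<in> {0, 1, 2}"
    moreover have "0 = c 0" "1 = c 1" "2 = c 3" "3 \<in> E"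
      using assms by (auto simp: c_def E_def)
    ultimately show "k \<in> c ` E" using two by blast
  qed (auto simp: c_def)
  then have "card (c ` E) = 3" by simp
  ultimately show ?thesis
    using matroid_rank_cocolor_indep[OF E(1) two] h_vector_cocolor_indep[OF E(1) two] E(2)
    by (intro exI[of _ E] exI[of _ "cocolor_indep E c"]) simp
qed

end
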